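(* Let $n\geqslant 0$ be an integer. (i) The Chebyshev polynomial $T_n(x)$ of the first kind is irreducible over $\mathbb{Q}$ if and only if $n$ is a power of $2$. (ii) The Chebyshev polynomials $V_n(x)$ and $W_n(x)$ of the third and fourth kinds are irreducible over $\mathbb{Q}$ if and only if $2n+1$ is a prime; that is, $V_n(x)$ is irreducible if and only if $2n+1$ is a prime, and likewise $W_n(x)$ is irreducible if and only if $2n+1$ is a prime.
   Context: The Chebyshev polynomials of the first kind are defined by $T_0(x)=1$, $T_1(x)=x$, $T_n(x)=2x\,T_{n-1}(x)-T_{n-2}(x)$ for $n\geqslant 2$. The Chebyshev polynomials of the second kind are defined by $U_{-1}(x)=0$, $U_0(x)=1$, $U_n(x)=2x\,U_{n-1}(x)-U_{n-2}(x)$ for $n\geqslant 1$. The Chebyshev polynomials of the third and fourth kinds are $V_n(x)=U_n(x)-U_{n-1}(x)$ and $W_n(x)=U_n(x)+U_{n-1}(x)$ for $n\geqslant 0$. Powers of $2$ include $2^0=1$, and constant polynomials are not regarded as irreducible. *)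

theory Defs
  imports "HOL-Computational_Algebra.Computational_Algebra"
begin

fun cheb_T :: "nat \<Rightarrow> rat poly" where
  "cheb_T 0 = 1"
| "cheb_T (Suc 0) = [:0, 1:]"
| "cheb_T (Suc (Suc n)) = [:0, 2:] * cheb_T (Suc n) - cheb_T n"

text \<open>Indexed by integers because the recursion starts at \<open>-1\<close>;
  the value \<open>0\<close> at indices below \<open>-1\<close> is junk and never used.\<close>

function cheb_U :: "int \<Rightarrow> rat poly" where
  "cheb_U n =
    (if n \<le> -1 then 0
     else if n = 0 then 1
     else [:0, 2:] * cheb_U (n - 1) - cheb_U (n - 2))"
  by auto
termination by (relation "measure (\<lambda>n. nat (n + 1))") auto

declare cheb_U.simps [simp del]

lemma cheb_U_minus_one: "cheb_U (-1) = 0"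
  by (simp add: cheb_U.simps)

lemma cheb_U_zero: "cheb_U 0 = 1"
  by (simp add: cheb_U.simps)

lemma cheb_U_rec:
  "n \<ge> 1 \<Longrightarrow> cheb_U n = [:0, 2:] * cheb_U (n - 1) - cheb_U (n - 2)"
  by (subst cheb_U.simps) simp

definition cheb_V :: "nat \<Rightarrow> rat poly" where
  "cheb_V n = cheb_U (int n) - cheb_U (int n - 1)"

definition cheb_W :: "nat \<Rightarrow> rat poly" where
  "cheb_W n = cheb_U (int n) + cheb_U (int n - 1)"

end

theory Submission
  imports Defs
begin

text \<open>
Irreducibility always comes from Eisenstein's criterion after a linear change of variable that
makes the polynomial monic (up to a constant factor) with integer coefficients.

For \<open>n = 2 ^ k\<close>, the polynomial \<open>2 T\<^sub>n(y/2)\<close> arises from \<open>y\<close> by applying \<open>D \<mapsto> D\<^sup>2 - 2\<close>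
\<open>k\<close> times. Modulo 2 this is plain squaring, so the result is \<open>y ^ n\<close> modulo 2, while for \<open>k > 0\<close>
its constant term is 2 modulo 4. Eisenstein applies at 2.

For prime \<open>p = 2 n + 1\<close>, put \<open>x = 1 + z/2\<close> with \<open>z = (s - 1/s)\<^sup>2\<close>. Then \<open>W\<^sub>n(x)\<close> becomes
\<open>(s ^ p - s ^ (-p)) / (s - 1/s)\<close>, which by Frobenius is \<open>(s - 1/s) ^ (p - 1) = z ^ n\<close> modulo \<open>p\<close>
and has the value \<open>p\<close> at \<open>z = 0\<close>. Eisenstein applies at \<open>p\<close>. The congruence is read off below
from a closed form of the coefficients: \<open>2 k + 1\<close> times the coefficient of \<open>z ^ k\<close> equals
\<open>2 n + 1\<close> times a binomial coefficient (\<open>W_coeff_closed_form\<close>).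

Conversely, the zeros of \<open>T\<^sub>m\<close> are zeros of \<open>T\<^sub>n\<close> when \<open>n\<close> is an odd multiple of \<open>m\<close>, because
\<open>T\<^sub>n(cos \<theta>) = cos (n \<theta>)\<close>; and those of \<open>W\<^sub>m\<close> are zeros of \<open>W\<^sub>n\<close> when \<open>2 m + 1\<close> divides
\<open>2 n + 1\<close>, because \<open>W\<^sub>n(cos \<theta>) = sin ((2 n + 1) \<theta>/2) / sin (\<theta>/2)\<close>. The divisibilities are proved
without trigonometry: every solution of the Chebyshev recurrence satisfies
\<open>g\<^sub>i\<^sub>+\<^sub>2\<^sub>h = 2 T\<^sub>h g\<^sub>i\<^sub>+\<^sub>h - g\<^sub>i\<close>, so a common divisor of \<open>g\<^sub>0\<close> and \<open>g\<^sub>h\<close> divides all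
\<open>g\<^sub>h\<^sub>j\<close> (\<open>dvd_at_multiples\<close>). This is applied to the sequences \<open>T\<close> and \<open>W\<close>, extended to
negative indices by \<open>T\<^sub>-\<^sub>k = T\<^sub>k\<close> and \<open>W\<^sub>-\<^sub>k\<^sub>-\<^sub>1 = - W\<^sub>k\<close>.

Polynomials of the third kind reduce to the fourth by \<open>V\<^sub>n(-x) = (-1) ^ n W\<^sub>n(x)\<close>.
\<close>

section \<open>Eisenstein's criterion\<close>

text \<open>If the product is not constant, \<open>p\<close> divides its constant term but \<open>p\<^sup>2\<close> does not, so \<open>p\<close> divides
the constant term of exactly one factor, say \<open>g\<close>. At the first index where \<open>p\<close> fails to divide the coefficient of \<open>g\<close>,
it also fails for the product; so this index is the degree of the product and \<open>h\<close> is constant.\<close>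

lemma eisenstein_factor_degree:
  fixes g h :: "'a :: idom poly"
  assumes p: "prime_elem p"
    and lead: "\<not> p dvd lead_coeff (g * h)"
    and low: "\<And>i. i < degree (g * h) \<Longrightarrow> p dvd coeff (g * h) i"
    and const: "\<not> p ^ 2 dvd coeff (g * h) 0"
  shows "degree g = 0 \<or> degree h = 0"
proof -
  have *: "degree h = 0"
    if p0: "p dvd coeff g 0"
      and lead: "\<not> p dvd lead_coeff (g * h)"
      and low: "\<And>i. i < degree (g * h) \<Longrightarrow> p dvd coeff (g * h) i"
      and const: "\<not> p ^ 2 dvd coeff (g * h) 0"
    for g h :: "'a poly"
  proof (rule ccontr)
    assume "degree h \<noteq> 0"
    have nz: "g \<noteq> 0" "h \<noteq> 0" using lead by auto
    have h0: "\<not> p dvd coeff h 0"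
      using p0 const by (auto simp: coeff_mult_0 power2_eq_square mult_dvd_mono)
    have lg: "\<not> p dvd lead_coeff g"
      using lead by (auto simp: lead_coeff_mult)
    define i where "i = (LEAST i. \<not> p dvd coeff g i)"
    have i: "\<not> p dvd coeff g i"
      unfolding i_def by (rule LeastI[of "\<lambda>i. \<not> p dvd coeff g i", OF lg])
    have i_le: "i \<le> degree g"
      unfolding i_def by (rule Least_le) (fact lg)
    have below: "p dvd coeff g j" if "j < i" for j
      using not_less_Least[of j "\<lambda>i. \<not> p dvd coeff g i"] that unfolding i_def by blast
    have "i < degree (g * h)"
      using i_le \<open>degree h \<noteq> 0\<close> nz by (simp add: degree_mult_eq)
    hence "p dvd coeff (g * h) i" by (rule low)
    also have "coeff (g * h) i = (\<Sum>j<i. coeff g j * coeff h (i - j)) + coeff g i * coeff h 0"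
      by (simp add: coeff_mult lessThan_Suc_atMost[symmetric])
    finally have "p dvd coeff g i * coeff h 0"
      by (subst (asm) dvd_add_right_iff) (auto intro!: dvd_sum dvd_mult2 below)
    thus False using i h0 p by (simp add: prime_elem_dvd_mult_iff)
  qed
  show ?thesis
  proof (cases "degree (g * h) = 0")
    case True
    have "g \<noteq> 0" "h \<noteq> 0" using lead by auto
    thus ?thesis using True by (simp add: degree_mult_eq)
  next
    case False
    hence "p dvd coeff (g * h) 0" by (intro low) simp
    hence "p dvd coeff g 0 \<or> p dvd coeff h 0"
      using p by (simp add: coeff_mult_0 prime_elem_dvd_mult_iff)
    thus ?thesis using *[of g h] *[of h g] lead low const by (auto simp: mult.commute)
  qed
qed

lemma map_poly_of_int_mult:
  "map_poly of_int (f * g) = map_poly of_int f * (map_poly of_int g :: 'a :: comm_ring_1 poly)"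
  by (rule poly_eqI) (simp add: coeff_map_poly coeff_mult)

lemma degree_map_poly_of_int [simp]:
  "degree (map_poly of_int f :: 'a :: ring_char_0 poly) = degree f"
  by (rule degree_map_poly) simp

lemma rat_poly_clear_denominators:
  fixes f :: "rat poly"
  obtains d :: int and F where "d > 0" "smult (of_int d) f = map_poly of_int F"
proof -
  have "\<exists>d F. d > 0 \<and> smult (of_int d) f = map_poly of_int F"
  proof (induction f)
    case 0
    show ?case by (intro exI[of _ 1] exI[of _ 0]) simp
  next
    case (pCons a f)
    then obtain d F where d: "d > 0" "smult (of_int d) f = map_poly of_int F" by blast
    obtain r s where rs: "a = of_int r / of_int s" "s > 0"
      using quotient_of_div[of a "fst (quotient_of a)" "snd (quotient_of a)"]
        quotient_of_denom_pos'[of a] by auto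
    have "smult (of_int (d * s)) (pCons a f)
        = pCons (of_int (d * r)) (smult (of_int s) (smult (of_int d) f))"
      using rs by (simp add: mult.commute)
    also have "\<dots> = map_poly of_int (pCons (d * r) (smult s F))"
      unfolding d(2) by (intro poly_eqI) (auto simp: coeff_map_poly coeff_pCons split: nat.splits)
    finally show ?case using d(1) rs(2) by (intro exI[of _ "d * s"]) auto
  qed
  thus ?thesis using that by blast
qed

text \<open>Gauss's lemma: primitive parts are multiplicative, and the positive factor \<open>d\<close> does not affect the
primitive part of \<open>f\<close>. So a rational factorization of a nonzero
polynomial, once its denominators are cleared, gives an
integral one whose factors have the same degrees.\<close>

lemma integer_factorization_of_multiple:
  fixes f g h :: "int poly"
  assumes "d > 0" "smult d f = g * h"
  shows "f = smult (content f) (primitive_part g) * primitive_part h"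
proof -
  have "primitive_part f = primitive_part (smult d f)"
    using assms(1) by (simp add: primitive_part_smult)
  also have "\<dots> = primitive_part g * primitive_part h"
    by (simp add: assms(2) primitive_part_mult)
  finally show ?thesis by (metis content_times_primitive_part mult_smult_left)
qed

lemma eisenstein_rat:
  fixes f :: "rat poly" and c :: "nat \<Rightarrow> int" and p :: int
  assumes c: "\<And>i. coeff f i = of_int (c i)"
    and p: "prime_elem p"
    and deg: "degree f > 0"
    and lead: "\<not> p dvd c (degree f)"
    and low: "\<And>i. i < degree f \<Longrightarrow> p dvd c i"
    and const: "\<not> p ^ 2 dvd c 0"
  shows "irreducible f"
proof -
  obtain F where F: "f = map_poly of_int F"
    by (rule intpolyE[of f]) (auto simp: c)
  have coeff_F: "coeff F i = c i" for i
    using c[of i] by (simp add: F coeff_map_poly)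
  have deg_F: "degree F = degree f" by (simp add: F)
  show ?thesis
  proof (rule irreducibleI)
    show "f \<noteq> 0" using deg by auto
    show "\<not> f dvd 1" using deg \<open>f \<noteq> 0\<close> by (simp add: is_unit_iff_degree)
    fix a b assume ab: "f = a * b"
    have nz: "a \<noteq> 0" "b \<noteq> 0" using \<open>f \<noteq> 0\<close> ab by auto
    obtain r A where A: "r > 0" "smult (of_int r) a = map_poly of_int A"
      by (rule rat_poly_clear_denominators)
    obtain s B where B: "s > 0" "smult (of_int s) b = map_poly of_int B"
      by (rule rat_poly_clear_denominators)
    have "map_poly of_int (smult (r * s) F) = smult (of_int (r * s)) f"
      by (simp add: F map_poly_smult)
    also have "\<dots> = smult (of_int r) a * smult (of_int s) b"
      by (simp add: ab mult.commute)
    also have "\<dots> = (map_poly of_int (A * B) :: rat poly)"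
      by (simp add: A B map_poly_of_int_mult)
    finally have "smult (r * s) F = A * B"
      by (simp add: poly_eq_iff coeff_map_poly flip: of_int_mult)
    hence FF: "F = smult (content F) (primitive_part A) * primitive_part B"
      using A B by (intro integer_factorization_of_multiple) auto
    have "degree (smult (content F) (primitive_part A)) = 0 \<or> degree (primitive_part B) = 0"
      by (rule eisenstein_factor_degree[of p], unfold FF[symmetric] deg_F coeff_F)
        (use p lead low const in auto)
    moreover have "content F \<noteq> 0" using deg deg_F by auto
    moreover have "degree a = degree A" "degree b = degree B"
      using A B by (metis degree_map_poly_of_int degree_smult_eq less_numeral_extra(3) of_int_eq_0_iff)+
    ultimately have "degree a = 0 \<or> degree b = 0" by simp
    thus "a dvd 1 \<or> b dvd 1" using nz by (simp add: is_unit_iff_degree)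
  qed
qed

section \<open>Irreducibility of polynomials over a field\<close>

lemma irreducible_pcompose_linearD:
  fixes f l :: "'a :: field poly"
  assumes "irreducible (pcompose f l)" "degree l = 1"
  shows "irreducible f"
proof (rule irreducibleI)
  show "f \<noteq> 0" using assms by auto
  have unit: "pcompose q l dvd 1 \<longleftrightarrow> q dvd 1" if "q \<noteq> 0" for q
    using that assms(2) by (simp add: is_unit_iff_degree pcompose_eq_0_iff degree_pcompose)
  show "\<not> f dvd 1"
    using assms(1) unit[OF \<open>f \<noteq> 0\<close>] by (auto simp: irreducible_def)
  fix a b assume ab: "f = a * b"
  hence "pcompose a l dvd 1 \<or> pcompose b l dvd 1"
    using assms(1) by (auto simp: pcompose_mult dest: irreducibleD)
  thus "a dvd 1 \<or> b dvd 1" using unit ab \<open>f \<noteq> 0\<close> by auto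
qed

lemma not_irreducible_if_smaller_dvd:
  fixes f g :: "'a :: field poly"
  assumes "g dvd f" "0 < degree g" "degree g < degree f"
  shows "\<not> irreducible f"
proof
  assume "irreducible f"
  then have "f dvd g \<or> g dvd 1" using assms(1) by (simp add: irreducible_altdef)
  moreover have "g \<noteq> 0" using assms(2) by auto
  ultimately show False
    using assms dvd_imp_degree_le[of f g] by (auto simp: is_unit_iff_degree)
qed

section \<open>Sequences satisfying the Chebyshev recurrence\<close>

text \<open>For \<open>g\<^sub>i = cos (\<alpha> + i \<theta>)\<close> this is the identity
\<open>cos (\<beta> + h \<theta>) + cos (\<beta> - h \<theta>) = 2 cos (h \<theta>) cos \<beta>\<close> with \<open>\<beta> = \<alpha> + (i + h) \<theta>\<close>. It says that
taking every \<open>h\<close>-th term gives a recurrence of the same shape with \<open>T\<^sub>h\<close> in place of \<open>x\<close>.\<close>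

lemma chebyshev_recurrence_step:
  fixes g :: "nat \<Rightarrow> rat poly"
  assumes rec: "\<And>i. g (i + 2) = [:0, 2:] * g (i + 1) - g i"
  shows "g (i + 2 * h) = 2 * cheb_T h * g (i + h) - g i"
proof (induction h arbitrary: i rule: cheb_T.induct)
  case 1
  show ?case by simp
next
  case 2
  have "2 * [:0, 1:] = ([:0, 2:] :: rat poly)" by (simp add: numeral_poly)
  then show ?case using rec[of i] by simp
next
  case (3 h)
  define x where "x = ([:0, 2:] :: rat poly)"
  have "g (i + 2 * Suc (Suc h)) = x * g (i + 2 * h + 3) - g (i + 2 * h + 2)"
    using rec[of "i + 2 * h + 2"] by (simp add: x_def numeral_eq_Suc)
  moreover have "g (i + 2 * h + 3) = 2 * cheb_T (Suc h) * g (i + h + 2) - g (i + 1)"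
    using 3(1)[of "i + 1"] by (simp add: numeral_eq_Suc)
  moreover have "g (i + 2 * h + 2) = 2 * cheb_T h * g (i + h + 2) - g (i + 2)"
    using 3(2)[of "i + 2"] by (simp add: numeral_eq_Suc)
  moreover have "g (i + 2) = x * g (i + 1) - g i"
    using rec[of i] by (simp add: x_def)
  moreover have "cheb_T (Suc (Suc h)) = x * cheb_T (Suc h) - cheb_T h"
    by (simp add: x_def)
  moreover have "i + Suc (Suc h) = i + h + 2" by simp
  ultimately show ?case by (simp only:) (simp add: algebra_simps)
qed

lemma dvd_at_multiples:
  fixes g :: "nat \<Rightarrow> rat poly"
  assumes rec: "\<And>i. g (i + 2) = [:0, 2:] * g (i + 1) - g i"
    and "d dvd g 0" "d dvd g h"
  shows "d dvd g (h * j)"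
proof (induction j rule: induct_nat_012)
  case (ge2 j)
  have "h * Suc (Suc j) = h * j + 2 * h" "h * Suc j = h * j + h" by simp_all
  hence "g (h * Suc (Suc j)) = 2 * cheb_T h * g (h * Suc j) - g (h * j)"
    by (simp only: chebyshev_recurrence_step[OF rec])
  then show ?case by (simp only: dvd_diff dvd_mult ge2)
qed (use assms in auto)

section \<open>First kind\<close>

lemma cheb_T_leading: "degree (cheb_T n) \<le> n" "coeff (cheb_T n) n \<noteq> 0"
proof -
  have "degree (cheb_T n) \<le> n \<and> coeff (cheb_T n) n > 0"
  proof (induction n rule: cheb_T.induct)
    case (3 n)
    have "coeff (cheb_T n) (Suc (Suc n)) = 0"
      using 3 by (intro coeff_eq_0) auto
    moreover have "degree ([:0, 2:] * cheb_T (Suc n)) \<le> Suc (Suc n)"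
      using 3 degree_mult_le[of "[:0, 2 :: rat:]" "cheb_T (Suc n)"] by simp
    ultimately show ?case using 3 by (auto intro!: degree_diff_le simp: mult_pCons_left)
  qed auto
  thus "degree (cheb_T n) \<le> n" "coeff (cheb_T n) n \<noteq> 0" by auto
qed

lemma degree_cheb_T [simp]: "degree (cheb_T n) = n"
  using cheb_T_leading[of n] by (intro antisym le_degree)

lemma cheb_T_double: "cheb_T (2 * n) = 2 * cheb_T n ^ 2 - 1"
  using chebyshev_recurrence_step[of cheb_T 0 n] by (simp add: power2_eq_square numeral_2_eq_2)

text \<open>The extended sequence \<open>T\<^sub>|\<^sub>k\<^sub>|\<close> satisfies the recurrence on all integers and takes the value
\<open>T\<^sub>m\<close> at \<open>-m\<close> and at \<open>m\<close>. These indices are \<open>2 m\<close> apart, so \<open>T\<^sub>m\<close> divides the terms at all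
indices congruent to \<open>m\<close> modulo \<open>2 m\<close>, which are the odd multiples of \<open>m\<close>.\<close>

lemma cheb_T_dvd_odd_multiple: "cheb_T m dvd cheb_T (m * (2 * j + 1))"
proof -
  define g where "g i = cheb_T (nat \<bar>int i - int m\<bar>)" for i
  have rec: "g (i + 2) = [:0, 2:] * g (i + 1) - g i" for i
  proof -
    consider "i \<ge> m" | "i + 1 = m" | "i + 2 \<le> m" by linarith
    then show ?thesis
    proof cases
      case 1
      then obtain k where "i = m + k" using le_Suc_ex by blast
      thus ?thesis by (simp add: g_def nat_add_distrib numeral_eq_Suc)
    next
      case 2
      thus ?thesis by (auto simp: g_def)
    next
      case 3
      then obtain k where "m = i + 2 + k" using le_Suc_ex by blast
      thus ?thesis by (simp add: g_def nat_add_distrib numeral_eq_Suc)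
    qed
  qed
  have "cheb_T m dvd g (2 * m * (j + 1))"
    by (rule dvd_at_multiples[OF rec]) (simp_all add: g_def)
  also have "g (2 * m * (j + 1)) = cheb_T (m * (2 * j + 1))"
  proof -
    have "int (2 * m * (j + 1)) - int m = int (m * (2 * j + 1))"
      by (simp add: algebra_simps)
    thus ?thesis by (simp only: g_def abs_of_nat nat_int)
  qed
  finally show ?thesis .
qed

text \<open>The Dickson polynomial of index \<open>2 ^ k\<close> with parameter 1: it sends \<open>t + 1/t\<close> to
\<open>t ^ (2 ^ k) + t ^ (- (2 ^ k))\<close>. It is defined directly by the doubling step, from which both
congruences needed for Eisenstein's criterion are immediate.\<close>

fun dickson_pow2 :: "nat \<Rightarrow> int poly" where
  "dickson_pow2 0 = [:0, 1:]"
| "dickson_pow2 (Suc k) = dickson_pow2 k ^ 2 - [:2:]"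

lemma dickson_pow2_eq:
  "map_poly of_int (dickson_pow2 k) = 2 * pcompose (cheb_T (2 ^ k)) [:0, 1 / 2:]"
proof (induction k)
  case 0
  show ?case by (simp add: pcompose_pCons map_poly_pCons numeral_poly)
next
  case (Suc k)
  let ?q = "pcompose (cheb_T (2 ^ k)) [:0, 1 / 2:]"
  have "(map_poly of_int (dickson_pow2 (Suc k)) :: rat poly)
      = map_poly of_int (dickson_pow2 k) ^ 2 - [:2:]"
    unfolding dickson_pow2.simps power2_eq_square map_poly_of_int_mult[symmetric]
    by (rule poly_eqI) (simp add: coeff_map_poly coeff_pCons split: nat.splits)
  also have "\<dots> = (2 * ?q) ^ 2 - 2" by (simp add: Suc numeral_poly)
  also have "\<dots> = 2 * (2 * ?q ^ 2 - 1)" by (simp add: power2_eq_square algebra_simps)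
  also have "\<dots> = 2 * pcompose (2 * cheb_T (2 ^ k) ^ 2 - 1) [:0, 1 / 2:]"
    by (simp add: pcompose_diff pcompose_mult pcompose_1 pcompose_smult power2_eq_square numeral_poly)
  finally show ?case by (simp add: cheb_T_double)
qed

lemma dickson_pow2_mod_2: "\<exists>q. dickson_pow2 k = monom 1 (2 ^ k) + smult 2 q"
proof (induction k)
  case 0
  show ?case by (intro exI[of _ 0]) (simp add: monom_altdef)
next
  case (Suc k)
  then obtain q where q: "dickson_pow2 k = monom 1 (2 ^ k) + smult 2 q" by blast
  have "monom (1 :: int) (2 ^ Suc k) = (monom 1 (2 ^ k)) ^ 2"
    by (simp add: power2_eq_square mult_monom mult_2)
  hence "dickson_pow2 (Suc k)
      = monom 1 (2 ^ Suc k) + smult 2 (2 * monom 1 (2 ^ k) * q + 2 * q ^ 2 - 1)"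
    by (simp add: q power2_eq_square algebra_simps smult_diff_right numeral_poly one_pCons
        smult_add_right)
  thus ?case by blast
qed

text \<open>The index starts at 1 because the constant term of \<open>dickson_pow2 0\<close> is 0. From \<open>k = 1\<close> on, the
class of 2 modulo 4 is fixed by \<open>c \<mapsto> c\<^sup>2 - 2\<close>.\<close>

lemma dickson_pow2_const: "coeff (dickson_pow2 (Suc k)) 0 mod 4 = 2"
proof (induction k)
  case (Suc k)
  then obtain t where t: "coeff (dickson_pow2 (Suc k)) 0 = 4 * t + 2"
    by (metis mod_eqE mult_div_mod_eq)
  have "coeff (dickson_pow2 (Suc (Suc k))) 0 = (4 * t + 2) ^ 2 - 2"
    unfolding dickson_pow2.simps(2)[of "Suc k"] coeff_diff power2_eq_square coeff_mult_0 t by simp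
  also have "\<dots> = 2 + 4 * (4 * t\<^sup>2 + 4 * t)" by (simp add: power2_eq_square algebra_simps)
  finally show ?case by presburger
qed (simp add: power2_eq_square)

lemma irreducible_cheb_T_pow2: "irreducible (cheb_T (2 ^ k))"
proof (cases k)
  case 0
  thus ?thesis by (simp add: irreducible_linear_field_poly)
next
  case (Suc j)
  let ?f = "pcompose (2 * cheb_T (2 ^ k)) [:0, 1 / 2 :: rat:]"
  have f: "?f = map_poly of_int (dickson_pow2 k)"
    by (simp add: dickson_pow2_eq pcompose_smult numeral_poly)
  have deg: "degree ?f = 2 ^ k"
    by (simp add: degree_pcompose numeral_poly)
  obtain q where q: "dickson_pow2 k = monom 1 (2 ^ k) + smult 2 q"
    using dickson_pow2_mod_2 by blast
  have "irreducible ?f"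
  proof (rule eisenstein_rat[of ?f "coeff (dickson_pow2 k)" 2])
    show "coeff ?f i = of_int (coeff (dickson_pow2 k) i)" for i
      by (simp only: f coeff_map_poly of_int_0)
    show "\<not> 2 dvd coeff (dickson_pow2 k) (degree ?f)"
      unfolding deg by (simp add: q)
    show "2 dvd coeff (dickson_pow2 k) i" if "i < degree ?f" for i
      using that unfolding deg by (simp add: q)
    show "\<not> 2\<^sup>2 dvd coeff (dickson_pow2 k) 0"
      using dickson_pow2_const[of j] by (auto simp: Suc)
  qed (auto simp: deg)
  hence "irreducible (2 * cheb_T (2 ^ k))"
    by (rule irreducible_pcompose_linearD) simp
  thus ?thesis
    by (subst (asm) irreducible_mult_unit_left) (auto simp: is_unit_iff_degree numeral_poly)
qed

text \<open>If \<open>n\<close> is not a power of 2, its odd part is \<open>2 j + 1\<close> with \<open>j > 0\<close>, and the cofactor \<open>2 ^ k\<close>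
gives the proper divisor \<open>T\<close> of index \<open>2 ^ k\<close>, which has positive degree.\<close>

lemma irreducible_cheb_T_iff: "irreducible (cheb_T n) \<longleftrightarrow> (\<exists>k. n = 2 ^ k)"
proof
  assume irr: "irreducible (cheb_T n)"
  have n: "n \<noteq> 0" using irr by (intro notI) simp
  obtain m where km: "n = 2 ^ multiplicity 2 n * m" "odd m"
    using multiplicity_decompose'[of n 2] n by auto
  define k where "k = multiplicity 2 n"
  note km = km[folded k_def]
  from km(2) obtain j where j: "m = 2 * j + 1" by (elim oddE)
  have "j = 0"
  proof (rule ccontr)
    assume "j \<noteq> 0"
    hence "\<not> irreducible (cheb_T n)"
      using cheb_T_dvd_odd_multiple[of "2 ^ k" j] km j
      by (intro not_irreducible_if_smaller_dvd[of "cheb_T (2 ^ k)"]) auto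
    thus False using irr by simp
  qed
  thus "\<exists>k. n = 2 ^ k" using km j by auto
next
  assume "\<exists>k. n = 2 ^ k"
  thus "irreducible (cheb_T n)" by (elim exE) (simp only: irreducible_cheb_T_pow2)
qed

section \<open>Third and fourth kinds\<close>

lemma cheb_U_Suc: "cheb_U (int n + 1) = [:0, 2:] * cheb_U (int n) - cheb_U (int n - 1)"
  using cheb_U_rec[of "int n + 1"] by simp

lemma cheb_U_add_2: "cheb_U (int n + 2) = [:0, 2:] * cheb_U (int n + 1) - cheb_U (int n)"
proof -
  have "int n + 2 - 1 = int n + 1" "int n + 2 - 2 = int n" by simp_all
  thus ?thesis using cheb_U_rec[of "int n + 2"] by (simp only:)
qed

lemma cheb_W_0: "cheb_W 0 = 1"
  and cheb_W_1: "cheb_W (Suc 0) = [:1, 2:]"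
  and cheb_W_rec: "cheb_W (Suc (Suc n)) = [:0, 2:] * cheb_W (Suc n) - cheb_W n"
proof -
  show "cheb_W 0 = 1" "cheb_W (Suc 0) = [:1, 2:]"
    using cheb_U_Suc[of 0]
    by (simp_all add: cheb_W_def cheb_U_zero cheb_U_minus_one one_pCons)
  have "cheb_W (Suc (Suc n)) = cheb_U (int n + 2) + cheb_U (int n + 1)"
    "cheb_W (Suc n) = cheb_U (int n + 1) + cheb_U (int n)"
    by (simp_all add: cheb_W_def algebra_simps)
  then show "cheb_W (Suc (Suc n)) = [:0, 2:] * cheb_W (Suc n) - cheb_W n"
    using cheb_U_Suc[of n] cheb_U_add_2[of n]
    by (simp add: cheb_W_def[of n] right_diff_distrib distrib_left del: mult_pCons_left)
qed

lemma cheb_V_0: "cheb_V 0 = 1"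
  and cheb_V_1: "cheb_V (Suc 0) = [:-1, 2:]"
  and cheb_V_rec: "cheb_V (Suc (Suc n)) = [:0, 2:] * cheb_V (Suc n) - cheb_V n"
proof -
  show "cheb_V 0 = 1" "cheb_V (Suc 0) = [:-1, 2:]"
    using cheb_U_Suc[of 0]
    by (simp_all add: cheb_V_def cheb_U_zero cheb_U_minus_one one_pCons)
  have "cheb_V (Suc (Suc n)) = cheb_U (int n + 2) - cheb_U (int n + 1)"
    "cheb_V (Suc n) = cheb_U (int n + 1) - cheb_U (int n)"
    by (simp_all add: cheb_V_def algebra_simps)
  then show "cheb_V (Suc (Suc n)) = [:0, 2:] * cheb_V (Suc n) - cheb_V n"
    using cheb_U_Suc[of n] cheb_U_add_2[of n]
    by (simp add: cheb_V_def[of n] right_diff_distrib distrib_left del: mult_pCons_left)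
qed

lemma cheb_V_reflect: "pcompose (cheb_V n) [:0, -1:] = smult ((-1) ^ n) (cheb_W n)"
proof (induction n rule: induct_nat_012)
  case (ge2 n)
  have "pcompose (cheb_V (Suc (Suc n))) [:0, -1:]
      = - [:0, 2:] * pcompose (cheb_V (Suc n)) [:0, -1:] - pcompose (cheb_V n) [:0, -1:]"
    by (simp add: cheb_V_rec pcompose_diff pcompose_mult pcompose_pCons pcompose_smult)
  also have "\<dots> = smult ((-1) ^ n) (cheb_W (Suc (Suc n)))"
    unfolding ge2 cheb_W_rec by (simp add: smult_diff_right)
  finally show ?case by simp
qed (simp_all add: cheb_V_0 cheb_V_1 cheb_W_0 cheb_W_1 pcompose_1 pcompose_pCons)

lemma irreducible_cheb_V_iff_W: "irreducible (cheb_V n) \<longleftrightarrow> irreducible (cheb_W n)"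
proof -
  have *: "irreducible (pcompose (cheb_V n) [:0, -1:]) \<longleftrightarrow> irreducible (cheb_W n)"
  proof -
    have "pcompose (cheb_V n) [:0, -1:] = [:(-1) ^ n:] * cheb_W n"
      by (simp add: cheb_V_reflect)
    thus ?thesis by (simp only:) (subst irreducible_mult_unit_left, auto simp: is_unit_iff_degree)
  qed
  have involution: "pcompose (pcompose (cheb_V n) [:0, -1:]) [:0, -1:] = cheb_V n"
    by (simp add: pcompose_assoc[symmetric] pcompose_pCons)
  show ?thesis
    using irreducible_pcompose_linearD[of "cheb_V n" "[:0, -1:]"]
      irreducible_pcompose_linearD[of "pcompose (cheb_V n) [:0, -1:]" "[:0, -1:]"]
    by (auto simp: involution *)
qed

text \<open>Under \<open>x = 1 + z/2\<close> the factor \<open>2 x\<close> becomes \<open>2 + z\<close>, so the recurrence for the coefficients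
has integer coefficients and is an instance of Pascal's rule applied twice.\<close>

lemma cheb_U_shifted_coeff:
  "coeff (pcompose (cheb_U (int n - 1)) [:1, 1 / 2:]) k = of_nat ((n + k) choose (2 * k + 1))"
proof (induction n arbitrary: k rule: induct_nat_012)
  case 0
  show ?case by (simp add: cheb_U_minus_one)
next
  case 1
  show ?case by (cases k) (simp_all add: cheb_U_zero pcompose_1 binomial_eq_0)
next
  case (ge2 n)
  let ?S = "\<lambda>n. pcompose (cheb_U (int n - 1)) [:1, 1 / 2 :: rat:]"
  have "?S (Suc (Suc n)) = [:2, 1:] * ?S (Suc n) - ?S n"
  proof -
    have "int (Suc (Suc n)) - 1 = int n + 1" "int (Suc n) - 1 = int n" by simp_all
    thus ?thesis
      by (simp only: cheb_U_Suc) (simp add: pcompose_diff pcompose_pCons pcompose_smult smult_add_right)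
  qed
  hence rec: "coeff (?S (Suc (Suc n))) k
      = 2 * coeff (?S (Suc n)) k + (case k of 0 \<Rightarrow> 0 | Suc j \<Rightarrow> coeff (?S (Suc n)) j)
        - coeff (?S n) k"
    by (simp add: mult_pCons_left coeff_pCons split: nat.splits)
  show ?case
  proof (cases k)
    case 0
    thus ?thesis unfolding rec ge2 by simp
  next
    case (Suc j)
    have "((n + j + 3) choose (2 * j + 3)) + ((n + j + 1) choose (2 * j + 3))
        = ((n + j + 1) choose (2 * j + 1)) + 2 * ((n + j + 2) choose (2 * j + 3))"
      by (simp add: numeral_eq_Suc)
    hence "(of_nat ((n + j + 3) choose (2 * j + 3)) :: rat)
        = of_nat ((n + j + 1) choose (2 * j + 1)) + 2 * of_nat ((n + j + 2) choose (2 * j + 3))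
          - of_nat ((n + j + 1) choose (2 * j + 3))"
      by (metis add_diff_cancel_right' of_nat_add of_nat_mult of_nat_numeral)
    thus ?thesis unfolding rec ge2 using Suc by (simp add: numeral_eq_Suc)
  qed
qed

text \<open>The coefficient of \<open>z ^ k\<close> in \<open>W\<^sub>n(1 + z/2)\<close>, as a natural number.\<close>

definition W_coeff :: "nat \<Rightarrow> nat \<Rightarrow> nat" where
  "W_coeff n k = ((n + k + 1) choose (2 * k + 1)) + ((n + k) choose (2 * k + 1))"

lemma cheb_W_shifted_coeff:
  "coeff (pcompose (cheb_W n) [:1, 1 / 2:]) k = of_nat (W_coeff n k)"
  using cheb_U_shifted_coeff[of n k] cheb_U_shifted_coeff[of "Suc n" k]
  by (simp add: cheb_W_def W_coeff_def pcompose_add)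

text \<open>For prime \<open>2 n + 1\<close> and \<open>k < n\<close>, the factor \<open>2 k + 1\<close> is coprime to \<open>2 n + 1\<close>, so the
coefficient itself is divisible by \<open>2 n + 1\<close>.\<close>

lemma W_coeff_closed_form: "(2 * k + 1) * W_coeff n k = (2 * n + 1) * ((n + k) choose (2 * k))"
proof -
  have "(2 * k + 1) * ((n + k + 1) choose (2 * k + 1)) = (n + k + 1) * ((n + k) choose (2 * k))"
    using Suc_times_binomial_eq[of "n + k" "2 * k"] by (simp add: algebra_simps)
  moreover have "(n + k + 1) choose (2 * k + 1)
      = ((n + k) choose (2 * k)) + ((n + k) choose (2 * k + 1))"
    by simp
  ultimately show ?thesis by (simp add: W_coeff_def algebra_simps)
qed

lemma W_coeff_top: "W_coeff n n = 1" "k > n \<Longrightarrow> W_coeff n k = 0"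
proof -
  have "n + n + 1 = 2 * n + 1" "n + n < 2 * n + 1" by simp_all
  thus "W_coeff n n = 1" by (simp only: W_coeff_def binomial_n_n binomial_eq_0)
  assume "k > n"
  hence "n + k + 1 < 2 * k + 1" "n + k < 2 * k + 1" by simp_all
  thus "W_coeff n k = 0" by (simp only: W_coeff_def binomial_eq_0)
qed

lemma degree_cheb_W [simp]: "degree (cheb_W n) = n"
proof -
  have "degree (pcompose (cheb_W n) [:1, 1 / 2:]) = n"
    by (intro antisym degree_le le_degree) (auto simp: cheb_W_shifted_coeff W_coeff_top)
  thus ?thesis by (simp add: degree_pcompose)
qed

lemma irreducible_cheb_W_prime:
  assumes "prime (2 * n + 1)"
  shows "irreducible (cheb_W n)"
proof -
  let ?f = "pcompose (cheb_W n) [:1, 1 / 2:]"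
  have n: "n > 0" using assms by (intro gr0I) auto
  have deg: "degree ?f = n" by (simp add: degree_pcompose)
  have "irreducible ?f"
  proof (rule eisenstein_rat[of ?f "\<lambda>k. int (W_coeff n k)" "int (2 * n + 1)"])
    show "prime_elem (int (2 * n + 1))"
      using assms by (simp only: prime_nat_int_transfer prime_imp_prime_elem)
    show "\<not> int (2 * n + 1) dvd int (W_coeff n (degree ?f))"
      unfolding deg W_coeff_top using n by simp
    show "int (2 * n + 1) dvd int (W_coeff n k)" if "k < degree ?f" for k
    proof -
      have "2 * n + 1 dvd (2 * k + 1) * W_coeff n k"
        by (simp only: W_coeff_closed_form dvd_triv_left)
      moreover have "\<not> 2 * n + 1 dvd 2 * k + 1"
        using that deg by (auto dest: dvd_imp_le)
      ultimately show ?thesis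
        using assms prime_dvd_mult_iff of_nat_dvd_iff by blast
    qed
    have "W_coeff n 0 = 2 * n + 1" by (simp add: W_coeff_def)
    thus "\<not> (int (2 * n + 1))\<^sup>2 dvd int (W_coeff n 0)"
      using n by (auto simp: power2_eq_square dest!: zdvd_imp_le)
  qed (auto simp: cheb_W_shifted_coeff deg n)
  thus ?thesis by (rule irreducible_pcompose_linearD) simp
qed

text \<open>The extension of \<open>W\<close> that is antisymmetric about \<open>-1/2\<close> satisfies the recurrence on all integers
and is \<open>- W\<^sub>m\<close> at \<open>-m - 1\<close> and \<open>W\<^sub>m\<close> at \<open>m\<close>. These indices are \<open>2 m + 1\<close> apart.\<close>

lemma cheb_W_dvd: "cheb_W m dvd cheb_W (m + (2 * m + 1) * q)"
proof -
  define F where "F k = (if k \<ge> 0 then cheb_W (nat k) else - cheb_W (nat (- k - 1)))" for k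
  \<comment> \<open>start the sequence at index \<open>-m - 1\<close>, so that \<open>W\<^sub>m\<close> divides the terms at 0 and \<open>2 m + 1\<close>\<close>
  define g where "g i = F (int i - int (m + 1))" for i
  have rec_F: "F (k + 2) = [:0, 2:] * F (k + 1) - F k" for k
  proof -
    consider "k \<ge> 0" | "k = -1" | "k = -2" | "k \<le> -3" by linarith
    then show ?thesis
    proof cases
      case 1
      thus ?thesis using cheb_W_rec[of "nat k"]
        by (simp add: F_def nat_add_distrib numeral_eq_Suc)
    next
      case 4
      define j where "j = nat (-k - 3)"
      have "k = - int j - 3" using 4 by (simp add: j_def)
      thus ?thesis using cheb_W_rec[of j]
        by (simp add: F_def nat_add_distrib numeral_eq_Suc)
    qed (simp_all add: F_def cheb_W_0 cheb_W_1 one_pCons)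
  qed
  have rec: "g (i + 2) = [:0, 2:] * g (i + 1) - g i" for i
    using rec_F[of "int i - int (m + 1)"] by (simp add: g_def algebra_simps)
  have "cheb_W m dvd g ((2 * m + 1) * (q + 1))"
    by (rule dvd_at_multiples[OF rec]) (simp_all add: g_def F_def)
  also have "g ((2 * m + 1) * (q + 1)) = cheb_W (m + (2 * m + 1) * q)"
  proof -
    have "int ((2 * m + 1) * (q + 1)) - int (m + 1) = int (m + (2 * m + 1) * q)"
      by (simp add: algebra_simps)
    thus ?thesis by (simp only: g_def F_def nat_int of_nat_0_le_iff if_True)
  qed
  finally show ?thesis .
qed

lemma irreducible_cheb_W_iff: "irreducible (cheb_W n) \<longleftrightarrow> prime (2 * n + 1)"
proof
  assume irr: "irreducible (cheb_W n)"
  have n: "n \<noteq> 0" using irr by (intro notI) (simp add: cheb_W_0)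
  show "prime (2 * n + 1)"
  proof (rule ccontr)
    assume "\<not> prime (2 * n + 1)"
    moreover have "1 < 2 * n + 1" using n by simp
    ultimately obtain a where a: "a dvd 2 * n + 1" "a \<noteq> 1" "a \<noteq> 2 * n + 1"
      unfolding prime_nat_iff by blast
    then obtain b where b: "2 * n + 1 = a * b" by (elim dvdE)
    have "odd (a * b)" unfolding b[symmetric] by simp
    hence "odd a" "odd b" by simp_all
    then obtain m q where mq: "a = 2 * m + 1" "b = 2 * q + 1" by (elim oddE) blast
    have n_eq: "n = m + (2 * m + 1) * q" using b by (simp add: mq algebra_simps)
    have "m \<noteq> 0" using a(2) mq(1) by simp
    moreover have "q \<noteq> 0" using a(3) b mq(2) by (intro notI) simp
    ultimately have "m < n" by (simp add: n_eq)
    have "\<not> irreducible (cheb_W n)"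
    proof (rule not_irreducible_if_smaller_dvd)
      show "cheb_W m dvd cheb_W n" unfolding n_eq by (rule cheb_W_dvd)
    qed (use \<open>m \<noteq> 0\<close> \<open>m < n\<close> in simp_all)
    thus False using irr by simp
  qed
qed (rule irreducible_cheb_W_prime)

section \<open>The criteria\<close>

theorem corollary1p7:
  fixes n :: nat
  shows "(irreducible (cheb_T n) \<longleftrightarrow> (\<exists>k::nat. n = 2 ^ k))
    \<and> (irreducible (cheb_V n) \<longleftrightarrow> prime (2 * n + 1))
    \<and> (irreducible (cheb_W n) \<longleftrightarrow> prime (2 * n + 1))"
  unfolding irreducible_cheb_T_iff irreducible_cheb_V_iff_W irreducible_cheb_W_iff
  by (intro conjI refl)

end
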